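(* Let $\pi$ be a permutation of length $n>2$ with exactly one descent, and write $\mu(\pi)=\mu(1,\pi)$. Then: (1) If $\mu(\pi)\neq0$, then $\mu(\pi)>0$ if and only if $n$ is odd. (2) If $\pi_1\pi_2=12$ or $\pi_{n-1}\pi_n=(n-1)n$, then $\mu(\pi)=0$. (3) If $\pi$ has a triple adjacency, then $\mu(\pi)=0$. (4) If $\pi$ has more than two adjacency pairs, then $\mu(\pi)=0$. (5) If $\pi$ has exactly two adjacency pairs: (a) if the first (leftmost) adjacency pair has greater value than the second, then $|\mu(\pi)|=1$; (b) if the first has lower value than the second, then $\mu(\pi)=0$. (6) If $\pi$ has exactly one adjacency pair, at position $i\in\{1,\dots,n-1\}$, and the descent is at position $d$, then: (a) if $i<d$ and $\pi_1\neq1$, $|\mu(\pi)|=i$; (b) if $i<d$ and $\pi_1=1$, $|\mu(\pi)|=i-1$; (c) if $i>d$ and $\pi_n\neq n$, $|\mu(\pi)|=n-i$; (d) if $i>d$ and $\pi_n=n$, $|\mu(\pi)|=n-i-1$. (7) If $\pi$ has no adjacency pairs, then: (a) if $n$ is even and $\pi_1=1$ (so $\pi=W_n$), $\mu(\pi)=-\binom{n/2}{2}$; (b) if $n$ is even and $\pi_1=2$ (so $\pi=M_n$), $\mu(\pi)=-\binom{n/2+1}{2}$; (c) if $n$ is odd, $\mu(\pi)=\binom{(n+1)/2}{2}$. (Where several cases apply simultaneously they give the same value.)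
   Context: A permutation of length $n$ is an arrangement $\pi=\pi_1\cdots\pi_n$ of $1,\dots,n$; $1$ denotes the permutation of length one. The permutation poset is ordered by pattern containment: $\sigma\le\pi$ if $\pi$ has a subsequence in the same relative order as $\sigma$. $\mu$ is its Möbius function: $\mu(a,a)=1$, $\mu(a,b)=-\sum_{a\le z<b}\mu(a,z)$ for $a<b$, $\mu(a,b)=0$ if $a\not\le b$. A descent is an index $d$ with $\pi_d>\pi_{d+1}$. An adjacency pair at position $i$ is an index $i$ with $\pi_{i+1}=\pi_i+1$; its value is $\pi_i$. A triple adjacency is an index $i$ with $\pi_{i+1}=\pi_i+1$ and $\pi_{i+2}=\pi_i+2$ (it consists of two adjacency pairs). The number of adjacency pairs is the number of indices $i$ with $\pi_{i+1}=\pi_i+1$. $M_n$ is the permutation listing the even numbers $2,4,\dots$ in increasing order followed by the odd numbers $1,3,\dots$ in increasing order (e.g. $M_6=246135$); $W_n$ lists the odd numbers in increasing order followed by the even numbers in increasing order (e.g. $W_5=13524$). *)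

theory Defs
  imports Main
begin

text \<open>Permutations of length n are lists of naturals, a rearrangement of 1..n.
  Positions are 1-based in the paper: pi_i = p ! (i - 1).\<close>

definition is_perm :: "nat list \<Rightarrow> bool" where
  "is_perm p \<longleftrightarrow> distinct p \<and> set p = {1..length p}"

definition order_iso :: "nat list \<Rightarrow> nat list \<Rightarrow> bool" where
  "order_iso xs ys \<longleftrightarrow> length xs = length ys \<and>
     (\<forall>i<length xs. \<forall>j<length xs. xs ! i < xs ! j \<longleftrightarrow> ys ! i < ys ! j)"

definition contains :: "nat list \<Rightarrow> nat list \<Rightarrow> bool" where
  "contains p s \<longleftrightarrow> (\<exists>I. I \<subseteq> {..<length p} \<and> order_iso (nths p I) s)"

text \<open>Moebius function mob a b of the permutation pattern poset (for permutations a, b).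
  The set {z. a \<le> z < b} of permutations is written with the (for permutations
  equivalent) condition length z < length b in place of z \<noteq> b.\<close>
function mob :: "nat list \<Rightarrow> nat list \<Rightarrow> int" where
  "mob a b = (if a = b then 1
     else if contains b a then
       - (\<Sum>z\<in>{z. is_perm z \<and> length z < length b \<and> contains z a \<and> contains b z}. mob a z)
     else 0)"
  by pat_completeness auto
termination
  by (relation "measure (\<lambda>(a, b). length b)") auto

definition mu :: "nat list \<Rightarrow> int" where
  "mu p = mob [1] p"

definition descents :: "nat list \<Rightarrow> nat set" where
  "descents p = {d. 1 \<le> d \<and> d < length p \<and> p ! (d - 1) > p ! d}"

definition adjs :: "nat list \<Rightarrow> nat set" where
  "adjs p = {i. 1 \<le> i \<and> i < length p \<and> p ! i = p ! (i - 1) + 1}"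

definition has_triple_adj :: "nat list \<Rightarrow> bool" where
  "has_triple_adj p \<longleftrightarrow> (\<exists>i. 1 \<le> i \<and> i + 2 \<le> length p \<and>
      p ! i = p ! (i - 1) + 1 \<and> p ! (i + 1) = p ! (i - 1) + 2)"

end

theory Submission
  imports Defs "HOL-Library.Sublist"
begin

text \<open>
  Colour each value of a one-descent permutation by whether it stands after the descent. This turns
  the permutations with at most one descent into words over two letters and pattern containment into
  the subword order, except that all words not containing the word [True, False] give the identity.
  The identities contribute 1 - 1 + 0 + ... = 0 to every Moebius sum, so the Moebius function of the
  permutation is, up to sign, that of the subword interval from [True, False] to the word. By a
  theorem of Bjoerner the latter counts normal embeddings, i.e. those using every position whose letter
  repeats the preceding one. Repeated letters are exactly the adjacency pairs.
\<close>

section \<open>Normal embeddings and the subword order\<close>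

text \<open>The obstacle is that \<open>perm_of\<close> is injective only on words containing
  \<open>[True, False]\<close>, so the Moebius recursion of permutations is not a sum over words.
  Splitting off the identities repairs this, but not quite without trace: below
  \<open>[True, False]\<close> itself only the identity of length one occurs, so there they
  contribute 1 and not 0. This starts the recursion on words at -1 and is the source of the minus
  sign in front of \<open>(-1) ^ length w\<close>. The case distinction of the theorem comes from
  the target word having only two letters. A normal embedding is a pair of positions, the first with
  letter True and the second with letter False, that covers every repetition. Three repetitions
  admit no pair, two admit at most one, a single repetition fixes one end and leaves the other to be
  counted, and without repetitions the word alternates and the pairs form a binomial
  coefficient.\<close>

text \<open>The optional letter c stands in front of w, so that these sets satisfy a recursion on w.\<close>

definition reps :: "'a option \<Rightarrow> 'a list \<Rightarrow> nat set" where
  "reps c w = {i. i < length w \<and> (c # map Some w) ! i = Some (w ! i)}"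

definition nemb :: "'a option \<Rightarrow> 'a list \<Rightarrow> 'a list \<Rightarrow> nat set set" where
  "nemb c v w = {I. I \<subseteq> {..<length w} \<and> reps c w \<subseteq> I \<and> nths w I = v}"

lemma reps_Cons: "reps c (a # w) = (if c = Some a then {0} else {}) \<union> Suc ` reps (Some a) w"
proof -
  have "i \<in> reps c (a # w) \<longleftrightarrow> i \<in> (if c = Some a then {0} else {}) \<union> Suc ` reps (Some a) w" for i
    by (cases i) (auto simp: reps_def image_iff)
  then show ?thesis by blast
qed

lemma finite_nemb: "finite (nemb c v w)"
  unfolding nemb_def by simp

lemma nemb_Nil: "nemb c v [] = (if v = [] then {{}} else {})"
  by (auto simp: nemb_def reps_def)

text \<open>Position 0 may be left out only if \<open>a\<close> does not repeat \<open>c\<close>.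
  Used or not, \<open>a\<close> is the letter in front of the remaining word.\<close>

lemma nemb_Cons:
  "nemb c v (a # w) =
     (if c = Some a then {} else (`) Suc ` nemb (Some a) v w) \<union>
     (if v \<noteq> [] \<and> hd v = a then (\<lambda>I. insert 0 (Suc ` I)) ` nemb (Some a) (tl v) w else {})"
  (is "?L = ?A \<union> ?B")
proof
  have pre: "{j. Suc j \<in> Suc ` I} = I" "{j. Suc j = 0 \<or> Suc j \<in> Suc ` I} = I" for I by auto
  show "?A \<union> ?B \<subseteq> ?L"
  proof
    fix I assume I: "I \<in> ?A \<union> ?B"
    show "I \<in> ?L"
    proof (cases "I \<in> ?A")
      case True
      then show ?thesis
        by (auto simp: nemb_def reps_Cons nths_Cons pre split: if_splits)
    next
      case False
      then obtain J where "v \<noteq> []" "hd v = a" "J \<in> nemb (Some a) (tl v) w" "I = insert 0 (Suc ` J)"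
        using I by (auto split: if_splits)
      then show ?thesis
        by (cases v) (auto simp: nemb_def reps_Cons nths_Cons pre)
    qed
  qed
  show "?L \<subseteq> ?A \<union> ?B"
  proof
    fix I assume I: "I \<in> ?L"
    define J where "J = {j. Suc j \<in> I}"
    have J: "J \<subseteq> {..<length w}" "reps (Some a) w \<subseteq> J"
      using I by (auto simp: nemb_def J_def reps_Cons)
    have n: "v = (if 0 \<in> I then [a] else []) @ nths w J"
      using I by (auto simp: nemb_def nths_Cons J_def)
    have IJ: "I = (if 0 \<in> I then insert 0 (Suc ` J) else Suc ` J)"
    proof -
      have "i \<in> I \<longleftrightarrow> i \<in> (if 0 \<in> I then insert 0 (Suc ` J) else Suc ` J)" for i
        by (cases i) (auto simp: J_def)
      then show ?thesis by blast
    qed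
    show "I \<in> ?A \<union> ?B"
    proof (cases "0 \<in> I")
      case True
      then have "J \<in> nemb (Some a) (tl v) w" "v \<noteq> []" "hd v = a" using J n by (auto simp: nemb_def)
      then show ?thesis using IJ True by auto
    next
      case False
      then have "J \<in> nemb (Some a) v w" "c \<noteq> Some a" using J n I by (auto simp: nemb_def reps_Cons split: if_splits)
      then show ?thesis using IJ False by auto
    qed
  qed
qed

lemma card_nemb_Cons:
  "card (nemb c v (a # w)) =
     (if c = Some a then 0 else card (nemb (Some a) v w)) +
     (if v \<noteq> [] \<and> hd v = a then card (nemb (Some a) (tl v) w) else 0)"
proof -
  have "inj_on ((`) Suc) X" for X by (auto simp: inj_on_def)
  moreover have "inj_on (\<lambda>I. insert 0 (Suc ` I)) X" for X
    by (rule inj_on_inverseI[where g = "\<lambda>I. {j. Suc j \<in> I}"]) auto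
  ultimately show ?thesis
    unfolding nemb_Cons by (subst card_Un_disjoint) (auto simp: finite_nemb card_image)
qed

text \<open>Up to the factor \<open>(-1) ^ length v\<close>, this adds over \<open>u\<close> in the
  interval from \<open>v\<close> to \<open>w\<close> the value that Bjoerner's theorem assigns to
  the interval from \<open>v\<close> to \<open>u\<close> (for \<open>c = None\<close>). Words
  \<open>u\<close> not above \<open>v\<close> have no embedding and add 0.\<close>

definition signed_nemb :: "'a option \<Rightarrow> 'a list \<Rightarrow> 'a list \<Rightarrow> int" where
  "signed_nemb c v w = (\<Sum>u | subseq u w. (-1) ^ length u * int (card (nemb c v u)))"

definition after_first :: "'a \<Rightarrow> 'a list \<Rightarrow> 'a list" where
  "after_first b w = tl (dropWhile (\<lambda>x. x \<noteq> b) w)"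

lemma split_first:
  assumes "b \<in> set w"
  obtains pre x where "w = pre @ b # x" "after_first b w = x" "b \<notin> set pre"
proof -
  obtain pre x where "w = pre @ b # x" "b \<notin> set pre"
    using split_list_first[OF assms] by blast
  moreover from this have "dropWhile (\<lambda>y. y \<noteq> b) w = b # x"
    by (induction pre arbitrary: w) auto
  then have "after_first b w = x" by (simp add: after_first_def)
  ultimately show thesis using that by blast
qed

lemma length_after_first: "b \<in> set w \<Longrightarrow> length (after_first b w) < length w"
  by (erule split_first) simp

text \<open>Greedy matching: the first letter of an embedded word can always be moved to the first
  occurrence of that letter.\<close>

lemma subseq_Cons_after_first:
  "subseq (b # u) w \<longleftrightarrow> b \<in> set w \<and> subseq u (after_first b w)"
  by (induction w) (auto simp: after_first_def)

text \<open>A suffix that begins with \<open>b\<close> cannot begin before the first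
  \<open>b\<close> of \<open>w\<close>, so the letters in front of that occurrence are
  irrelevant.\<close>

lemma suffix_Cons_after_first:
  assumes "b \<in> set w"
  shows "suffix (b # v) (b # after_first b w) \<longleftrightarrow> suffix (b # v) w"
proof -
  obtain pre x where w: "w = pre @ b # x" "after_first b w = x" "b \<notin> set pre"
    using split_first[OF assms] .
  have "suffix (b # v) (b # x)" if "b # v = xs' @ b # x" "suffix xs' pre" for xs'
    using that w(3) by (cases xs') (auto dest: set_mono_suffix)
  then show ?thesis
    unfolding w(2) unfolding w(1) by (auto simp: suffix_append)
qed

text \<open>The nonempty subwords are grouped by their first letter \<open>b\<close>. Greedy
  matching describes the rest as an arbitrary subword of \<open>after_first b w\<close>, so every
  subword is counted once, however often it embeds. The minus sign comes from the letter removed,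
  and the two summands from whether that letter is used by the normal embedding.\<close>

lemma signed_nemb_rec:
  "signed_nemb c v w = (if v = [] then 1 else 0)
     - (\<Sum>b\<in>set w. (if c = Some b then 0 else signed_nemb (Some b) v (after_first b w))
        + (if v \<noteq> [] \<and> hd v = b then signed_nemb (Some b) (tl v) (after_first b w) else 0))"
proof -
  let ?f = "\<lambda>u. (-1) ^ length u * int (card (nemb c v u))"
  let ?S = "\<lambda>w. {u. subseq u w}"
  have fin: "finite (?S w)" for w :: "'a list"
  proof -
    have "?S w = set (subseqs w)" by auto
    then show ?thesis by simp
  qed
  have split: "?S w = insert [] (\<Union>b\<in>set w. (#) b ` ?S (after_first b w))"
  proof -
    have "u \<in> ?S w \<longleftrightarrow> u \<in> insert [] (\<Union>b\<in>set w. (#) b ` ?S (after_first b w))" for u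
      by (cases u) (auto simp: subseq_Cons_after_first)
    then show ?thesis by blast
  qed
  have "signed_nemb c v w = ?f [] + (\<Sum>u\<in>(\<Union>b\<in>set w. (#) b ` ?S (after_first b w)). ?f u)"
    unfolding signed_nemb_def split by (subst sum.insert) (auto simp: fin)
  also have "(\<Sum>u\<in>(\<Union>b\<in>set w. (#) b ` ?S (after_first b w)). ?f u)
      = (\<Sum>b\<in>set w. \<Sum>u\<in>(#) b ` ?S (after_first b w). ?f u)"
    by (rule sum.UNION_disjoint) (auto simp: fin)
  also have "\<dots> = (\<Sum>b\<in>set w. \<Sum>u\<in>?S (after_first b w). ?f (b # u))"
    by (simp add: sum.reindex)
  also have "\<dots> = (\<Sum>b\<in>set w. - ((if c = Some b then 0 else signed_nemb (Some b) v (after_first b w))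
        + (if v \<noteq> [] \<and> hd v = b then signed_nemb (Some b) (tl v) (after_first b w) else 0)))"
    by (intro sum.cong refl)
      (simp add: card_nemb_Cons signed_nemb_def sum_negf sum_subtractf algebra_simps)
  finally show ?thesis
    by (simp only: nemb_Nil sum_negf) simp
qed

text \<open>
  The first equation is Bjoerner's theorem. It is proved together with the second one because
  splitting off the first letter of the summation variable turns each into instances of the second
  for the shorter word after the first occurrence of that letter.
\<close>

lemma signed_nemb_eq:
  "signed_nemb None v w = (if v = w then (-1) ^ length v else 0) \<and>
   signed_nemb (Some c) v w = (if suffix (c # v) (c # w) then (-1) ^ length v else 0)"
proof (induction "length w" arbitrary: c v w rule: less_induct)
  case less
  let ?s = "(-1) ^ length v :: int"
  have IH: "signed_nemb (Some b) x (after_first b w) = (if suffix (b # x) w then (-1) ^ length x else 0)"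
    if "b \<in> set w" for b x
    using less[OF length_after_first[OF that]] suffix_Cons_after_first[OF that] by metis
  let ?T = "\<lambda>b. if v \<noteq> [] \<and> hd v = b then signed_nemb (Some b) (tl v) (after_first b w) else 0"
  let ?U = "\<lambda>b. signed_nemb (Some b) v (after_first b w)"
  \<comment> \<open>Only \<open>b = hd v\<close> contributes, and \<open>tl v\<close> is one letter
    shorter than \<open>v\<close>, which turns \<open>?s\<close> into \<open>- ?s\<close>.\<close>
  have T: "(\<Sum>b\<in>set w. ?T b) = (if v \<noteq> [] \<and> suffix v w then - ?s else 0)"
  proof (cases v)
    case (Cons a x)
    have "(\<Sum>b\<in>set w. ?T b) = (\<Sum>b\<in>set w. if a = b then (if suffix v w then - ?s else 0) else 0)"
      by (rule sum.cong) (auto simp: Cons IH)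
    also have "\<dots> = (if v \<noteq> [] \<and> suffix v w then - ?s else 0)"
      using Cons set_mono_suffix[of v w] by (auto simp: sum.delta')
    finally show ?thesis .
  qed simp
  \<comment> \<open>If \<open>v\<close> is a strict suffix of \<open>w\<close>, then
    \<open>b # v\<close> is a suffix for exactly one \<open>b\<close>, the letter standing in front
    of \<open>v\<close>.\<close>
  have U: "(\<Sum>b\<in>set w. ?U b) = (if strict_suffix v w then ?s else 0)"
  proof (cases "strict_suffix v w")
    case True
    then obtain y where y: "w = y @ v" "y \<noteq> []" by (auto simp: strict_suffix_def suffix_def)
    then obtain z d where z: "w = z @ d # v" by (cases y rule: rev_cases) auto
    have "suffix (b # v) w \<longleftrightarrow> b = d" for b
      unfolding z suffix_def by auto
    then have "(\<Sum>b\<in>set w. ?U b) = (\<Sum>b\<in>set w. if b = d then ?s else 0)"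
      by (intro sum.cong) (auto simp: IH)
    then show ?thesis using True by (simp add: z)
  next
    case False
    have "\<not> suffix (b # v) w" for b
      using False by (auto simp: strict_suffix_def suffix_def)
    then show ?thesis using False by (simp add: IH)
  qed
  \<comment> \<open>For a strict suffix \<open>v\<close> the contributions of \<open>?U\<close> and
    \<open>?T\<close> cancel; for \<open>v = []\<close> the constant 1 of the recursion takes the
    place of \<open>?T\<close>.\<close>
  have 1: "signed_nemb None v w = (if v = w then ?s else 0)"
    unfolding signed_nemb_rec[of None] using T U
    by (auto simp: sum.distrib strict_suffix_def)
  \<comment> \<open>The recursions for \<open>None\<close> and \<open>Some c\<close> differ only in
    the term \<open>?U c\<close>, which the latter omits.\<close>
  have "signed_nemb (Some c) v w = signed_nemb None v w + (\<Sum>b\<in>set w. if c = b then ?U b else 0)"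
  proof -
    have "(\<Sum>b\<in>set w. ?U b + ?T b)
        = (\<Sum>b\<in>set w. ((if c = b then 0 else ?U b) + ?T b) + (if c = b then ?U b else 0))"
      by (rule sum.cong) auto
    then show ?thesis
      unfolding signed_nemb_rec[of None v w] signed_nemb_rec[of "Some c" v w]
      by (simp add: sum.distrib)
  qed
  also have "\<dots> = (if v = w then ?s else 0) + (if suffix (c # v) w then ?s else 0)"
    unfolding 1 using IH[of c v] set_mono_suffix[of "c # v" w] by (auto simp: sum.delta')
  also have "\<dots> = (if suffix (c # v) (c # w) then ?s else 0)"
    by (auto simp: suffix_Cons dest: suffix_length_le)
  finally show ?case using 1 by blast
qed

section \<open>Words and permutations with at most one descent\<close>

text \<open>w ! v tells whether the value v + 1 stands after the descent.\<close>

definition perm_of :: "bool list \<Rightarrow> nat list" where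
  "perm_of w = map Suc (filter (\<lambda>i. \<not> w ! i) [0..<length w] @ filter (\<lambda>i. w ! i) [0..<length w])"

text \<open>If \<open>perm_of w\<close> has a descent, this is its 1-based position and also the
  0-based index of the first entry after it.\<close>

definition first_run :: "bool list \<Rightarrow> nat" where
  "first_run w = length (filter (\<lambda>i. \<not> w ! i) [0..<length w])"

lemma length_perm_of [simp]: "length (perm_of w) = length w"
  unfolding perm_of_def using sum_length_filter_compl[of "\<lambda>i. \<not> w ! i" "[0..<length w]"] by simp

lemma distinct_perm_of: "distinct (perm_of w)"
  unfolding perm_of_def by (auto simp: distinct_map)

lemma set_perm_of: "set (perm_of w) = {1..length w}"
proof -
  have "set (perm_of w) = Suc ` {0..<length w}"
    unfolding perm_of_def set_map by (rule arg_cong[where f = "(`) Suc"]) auto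
  then show ?thesis by (simp only: image_Suc_atLeastLessThan atLeastLessThanSuc_atLeastAtMost One_nat_def)
qed

lemma is_perm_perm_of: "is_perm (perm_of w)"
  by (simp add: is_perm_def distinct_perm_of set_perm_of)

lemma first_run_le: "first_run w \<le> length w"
  unfolding first_run_def using length_filter_le[of _ "[0..<length w]"] by simp

lemma perm_of_nth_letter:
  assumes "k < length w"
  shows "w ! (perm_of w ! k - 1) \<longleftrightarrow> first_run w \<le> k"
proof -
  let ?A = "filter (\<lambda>i. \<not> w ! i) [0..<length w]" and ?B = "filter (\<lambda>i. w ! i) [0..<length w]"
  have l: "k < length (?A @ ?B)" using assms length_perm_of[of w] by (simp add: perm_of_def)
  show ?thesis
  proof (cases "k < length ?A")
    case True
    then have "?A ! k \<in> set ?A" by (rule nth_mem)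
    with True show ?thesis by (simp add: perm_of_def first_run_def nth_append)
  next
    case False
    then have "?B ! (k - length ?A) \<in> set ?B" using l by (intro nth_mem) simp
    with False l show ?thesis by (simp add: perm_of_def first_run_def nth_append)
  qed
qed

lemma perm_of_increasing:
  assumes "k < l" "l < length w" "l < first_run w \<or> first_run w \<le> k"
  shows "perm_of w ! k < perm_of w ! l"
proof -
  let ?A = "filter (\<lambda>i. \<not> w ! i) [0..<length w]" and ?B = "filter (\<lambda>i. w ! i) [0..<length w]"
  have l: "l < length (?A @ ?B)" using assms length_perm_of[of w] by (simp add: perm_of_def)
  have s: "sorted_wrt (<) (filter P [0..<length w])" for P
    by (rule sorted_wrt_filter) simp
  show ?thesis
    using assms(1,3) l sorted_wrt_nth_less[OF s, of k l "\<lambda>i. \<not> w ! i"]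
      sorted_wrt_nth_less[OF s, of "k - length ?A" "l - length ?A" "\<lambda>i. w ! i"]
    by (auto simp: perm_of_def first_run_def nth_append)
qed

lemma perm_of_value:
  assumes "i < length w"
  obtains k where "k < length w" "perm_of w ! k = Suc i"
proof -
  have "Suc i \<in> set (perm_of w)" using assms by (simp add: set_perm_of)
  then show thesis using that by (auto simp: in_set_conv_nth)
qed

section \<open>Pattern containment as the subword order\<close>

lemma nths_conv_map: "nths xs I = map ((!) xs) (filter (\<lambda>i. i \<in> I) [0..<length xs])"
proof -
  have "zip xs [0..<length xs] = map (\<lambda>i. (xs ! i, i)) [0..<length xs]"
    by (rule nth_equalityI) auto
  then show ?thesis by (simp add: nths_def filter_map o_def)
qed

lemma nths_pair:
  assumes "i < j" "j < length w"
  shows "nths w {i, j} = [w ! i, w ! j]"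
proof -
  have "filter (\<lambda>k. k \<in> {i, j}) [0..<length w] = [i, j]"
    using assms by (intro sorted_distinct_set_unique) (auto intro: sorted_wrt_filter)
  then show ?thesis by (simp add: nths_conv_map)
qed

lemma nths_eq_pairE:
  assumes "nths w I = [a, b]" "I \<subseteq> {..<length w}"
  obtains i j where "i < j" "j < length w" "I = {i, j}" "w ! i = a" "w ! j = b"
proof -
  have "{i. i < length w \<and> i \<in> I} = I" using assms(2) by auto
  then have "card I = 2" using assms(1) length_nths[of w I] by simp
  then obtain i j where ij: "I = {i, j}" "i < j"
    by (metis card_2_iff insert_commute linorder_less_linear)
  then show thesis using nths_pair[of i j w] assms by (intro that[of i j]) auto
qed

lemma subseq_pair_iff:
  "subseq [a, b] w \<longleftrightarrow> (\<exists>i j. i < j \<and> j < length w \<and> w ! i = a \<and> w ! j = b)"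
proof
  assume "subseq [a, b] w"
  then obtain I where "nths w I = [a, b]" by (metis subseq_conv_nths)
  moreover have "filter (\<lambda>i. i \<in> I \<inter> {..<length w}) [0..<length w] = filter (\<lambda>i. i \<in> I) [0..<length w]"
    by (rule filter_cong) auto
  ultimately have "nths w (I \<inter> {..<length w}) = [a, b]"
    by (simp only: nths_conv_map)
  then show "\<exists>i j. i < j \<and> j < length w \<and> w ! i = a \<and> w ! j = b"
    by (rule nths_eq_pairE) blast+
qed (metis nths_pair subseq_conv_nths)

lemma order_iso_sym: "order_iso xs ys \<Longrightarrow> order_iso ys xs"
  and order_iso_trans: "order_iso xs ys \<Longrightarrow> order_iso ys zs \<Longrightarrow> order_iso xs zs"
  by (auto simp: order_iso_def)

lemma order_iso_map:
  assumes "\<And>x y. x \<in> set xs \<Longrightarrow> y \<in> set xs \<Longrightarrow> f x < f y \<longleftrightarrow> g x < g y"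
  shows "order_iso (map f xs) (map g xs)"
  using assms by (simp add: order_iso_def)

text \<open>The right-hand side depends only on the relative order of the entries, so order
  isomorphic permutations coincide.\<close>

lemma is_perm_nth_eq_card:
  assumes "is_perm p" "i < length p"
  shows "p ! i = Suc (card {j. j < length p \<and> p ! j < p ! i})"
proof -
  have d: "distinct p" "set p = {1..length p}" using assms by (auto simp: is_perm_def)
  have "(!) p ` {j. j < length p \<and> p ! j < p ! i} = {1..<p ! i}"
  proof
    show "{1..<p ! i} \<subseteq> (!) p ` {j. j < length p \<and> p ! j < p ! i}"
    proof
      fix x assume x: "x \<in> {1..<p ! i}"
      have "p ! i \<in> set p" using assms by simp
      then have "x \<in> set p" using x d by auto
      then show "x \<in> (!) p ` {j. j < length p \<and> p ! j < p ! i}" using x by (auto simp: in_set_conv_nth)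
    qed
    show "(!) p ` {j. j < length p \<and> p ! j < p ! i} \<subseteq> {1..<p ! i}"
    proof
      fix x assume "x \<in> (!) p ` {j. j < length p \<and> p ! j < p ! i}"
      then have "x \<in> set p" "x < p ! i" by auto
      then show "x \<in> {1..<p ! i}" using d by auto
    qed
  qed
  moreover have "inj_on ((!) p) {j. j < length p \<and> p ! j < p ! i}"
    by (rule inj_on_nth[OF d(1)]) auto
  ultimately have "card {j. j < length p \<and> p ! j < p ! i} = p ! i - 1"
    using card_image[of "(!) p" "{j. j < length p \<and> p ! j < p ! i}"] by simp
  moreover have "p ! i \<ge> 1" using d assms nth_mem[of i p] by auto
  ultimately show ?thesis by simp
qed

lemma order_iso_perm_eq:
  assumes "is_perm p" "is_perm q" "order_iso p q"
  shows "p = q"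
proof (rule nth_equalityI)
  show l: "length p = length q" using assms by (simp add: order_iso_def)
  fix i assume i: "i < length p"
  have "{j. j < length p \<and> p ! j < p ! i} = {j. j < length q \<and> q ! j < q ! i}"
    using assms(3) i l by (auto simp: order_iso_def)
  then show "p ! i = q ! i"
    using is_perm_nth_eq_card[OF assms(1), of i] is_perm_nth_eq_card[OF assms(2), of i] i l by simp
qed

text \<open>Deleting values from the permutation is deleting letters from the word. \<open>K\<close>
  lists the kept values, shifted to start at 0, and \<open>j\<close> is the rank of
  \<open>K ! j\<close> among them; as \<open>K\<close> increases, replacing each kept value by its
  rank preserves the order.\<close>

lemma order_iso_filter_perm_of:
  "order_iso (filter (\<lambda>x. x \<in> V) (perm_of w)) (perm_of (nths w {i. Suc i \<in> V}))"
proof -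
  define K where "K = filter (\<lambda>i. Suc i \<in> V) [0..<length w]"
  define u where "u = nths w {i. Suc i \<in> V}"
  have u: "u = map ((!) w) K" by (simp add: u_def K_def nths_conv_map)
  let ?N = "[0..<length K]"
  let ?xs = "filter (\<lambda>j. \<not> u ! j) ?N @ filter (\<lambda>j. u ! j) ?N"
  have KP: "filter P K = map ((!) K) (filter (\<lambda>j. P (K ! j)) ?N)" for P
  proof -
    have "filter P K = filter P (map ((!) K) ?N)" by (simp add: map_nth)
    then show ?thesis by (simp only: filter_map o_def)
  qed
  have uK: "filter (\<lambda>j. \<not> w ! (K ! j)) ?N = filter (\<lambda>j. \<not> u ! j) ?N"
    "filter (\<lambda>j. w ! (K ! j)) ?N = filter (\<lambda>j. u ! j) ?N"
    by (auto simp: u intro!: filter_cong)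
  have "filter (\<lambda>x. x \<in> V) (perm_of w) = map Suc (filter (\<lambda>i. \<not> w ! i) K @ filter (\<lambda>i. w ! i) K)"
    by (simp add: perm_of_def K_def filter_map o_def conj_commute)
  also have "\<dots> = map (\<lambda>j. Suc (K ! j)) ?xs"
    unfolding KP uK by simp
  finally have 1: "filter (\<lambda>x. x \<in> V) (perm_of w) = map (\<lambda>j. Suc (K ! j)) ?xs" .
  have 2: "perm_of u = map Suc ?xs" by (simp add: perm_of_def u)
  have s: "sorted_wrt (<) K" unfolding K_def by (rule sorted_wrt_filter) simp
  have "K ! i < K ! j \<longleftrightarrow> i < j" if "i < length K" "j < length K" for i j
    using sorted_wrt_nth_less[OF s, of i j] sorted_wrt_nth_less[OF s, of j i] that
    by (metis less_asym linorder_less_linear)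
  then show ?thesis
    unfolding 1 2 u_def[symmetric] by (intro order_iso_map) auto
qed

text \<open>Containment selects positions, while letters are indexed by values. Since the entries
  are distinct, a set of positions and the set of values standing there determine each
  other.\<close>

lemma contains_perm_of_iff:
  assumes "is_perm z"
  shows "contains (perm_of w) z \<longleftrightarrow> (\<exists>u. subseq u w \<and> z = perm_of u)"
proof
  assume "contains (perm_of w) z"
  then obtain I where I: "order_iso (nths (perm_of w) I) z" by (auto simp: contains_def)
  define V where "V = set (nths (perm_of w) I)"
  have "nths (perm_of w) I = filter (\<lambda>x. x \<in> V) (perm_of w)"
    unfolding V_def by (rule filter_in_nths[OF distinct_perm_of, symmetric])
  then have "order_iso (perm_of (nths w {i. Suc i \<in> V})) z"
    using I order_iso_filter_perm_of order_iso_sym order_iso_trans by metis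
  then have "z = perm_of (nths w {i. Suc i \<in> V})"
    using order_iso_perm_eq[OF is_perm_perm_of assms] by metis
  then show "\<exists>u. subseq u w \<and> z = perm_of u" by (metis subseq_conv_nths)
next
  assume "\<exists>u. subseq u w \<and> z = perm_of u"
  then obtain J where z: "z = perm_of (nths w J)" by (metis subseq_conv_nths)
  have "order_iso (filter (\<lambda>x. x \<in> Suc ` J) (perm_of w)) z"
    using order_iso_filter_perm_of[of "Suc ` J" w] unfolding z by (simp add: inj_image_mem_iff)
  moreover have "filter (\<lambda>x. x \<in> Suc ` J) (perm_of w)
      = nths (perm_of w) {i. i < length (perm_of w) \<and> perm_of w ! i \<in> Suc ` J}"
    by (simp add: filter_eq_nths)
  ultimately show "contains (perm_of w) z"
    unfolding contains_def by (metis (no_types, lifting) lessThan_iff mem_Collect_eq subsetI)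
qed

section \<open>Identities, and uniqueness of the word otherwise\<close>

lemma sorted_perm_of_iff: "sorted (perm_of w) \<longleftrightarrow> \<not> subseq [True, False] w"
proof
  assume s: "sorted (perm_of w)"
  show "\<not> subseq [True, False] w"
  proof
    assume "subseq [True, False] w"
    then obtain i j where ij: "i < j" "j < length w" "w ! i" "\<not> w ! j"
      by (auto simp: subseq_pair_iff)
    obtain k where k: "k < length w" "perm_of w ! k = Suc i" using perm_of_value[of i w] ij by auto
    obtain l where l: "l < length w" "perm_of w ! l = Suc j" using perm_of_value[of j w] ij by auto
    have "first_run w \<le> k" "\<not> first_run w \<le> l"
      using perm_of_nth_letter[OF k(1)] perm_of_nth_letter[OF l(1)] k l ij by auto
    then have "Suc j \<le> Suc i" using sorted_nth_mono[OF s, of l k] k l by simp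
    then show False using ij by simp
  qed
next
  assume n: "\<not> subseq [True, False] w"
  have "x \<le> y" if "x < length w" "y < length w" "\<not> w ! x" "w ! y" for x y
    using n that by (force simp: subseq_pair_iff not_le[symmetric])
  then show "sorted (perm_of w)"
    by (auto simp: perm_of_def sorted_append sorted_map intro!: sorted_wrt_filter)
qed

lemma perm_of_eq_upt:
  assumes "\<not> subseq [True, False] w"
  shows "perm_of w = [1..<Suc (length w)]"
  using assms by (intro sorted_distinct_set_unique)
    (auto simp: sorted_perm_of_iff distinct_perm_of set_perm_of simp del: upt_Suc)

text \<open>If two words with different \<open>first_run\<close> gave the same permutation, the
  first run of one and the second run of the other would overlap and cover all positions, so the
  permutation would be sorted. Hence \<open>first_run\<close> is determined, and with it every
  letter.\<close>

lemma perm_of_inj: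
  assumes eq: "perm_of u = perm_of w" and u: "subseq [True, False] u"
  shows "u = w"
proof -
  have len: "length u = length w" using eq by (metis length_perm_of)
  have sorted_if: "sorted (perm_of x)"
    if xy: "perm_of x = perm_of y" "first_run x < first_run y" for x y
  proof -
    have l: "length x = length y" using xy by (metis length_perm_of)
    have "perm_of x ! k < perm_of x ! m" if km: "k < m" "m < length x" for k m
    proof (cases "m < first_run y \<or> first_run x \<le> k")
      case True
      then show ?thesis using perm_of_increasing[of k m x] perm_of_increasing[of k m y] km xy l by auto
    next
      case False
      then show ?thesis
        \<comment> \<open>The position \<open>first_run x\<close> lies in both runs and links
          \<open>k\<close> to \<open>m\<close>.\<close>
        using perm_of_increasing[of k "first_run x" y] perm_of_increasing[of "first_run x" m x] km xy l
        by force
    qed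
    then show ?thesis by (simp add: sorted_iff_nth_mono_less less_imp_le)
  qed
  have "first_run u = first_run w"
    using sorted_if[of u w] sorted_if[of w u] eq u sorted_perm_of_iff[of u]
    by (metis linorder_less_linear)
  show ?thesis
  proof (rule nth_equalityI[OF len])
    fix i assume "i < length u"
    then obtain k where "k < length u" "perm_of u ! k = Suc i" using perm_of_value by blast
    then show "u ! i = w ! i"
      using perm_of_nth_letter[of k u] perm_of_nth_letter[of k w] eq len \<open>first_run u = first_run w\<close>
      by simp
  qed
qed

text \<open>A sorted list of distinct entries is determined by its set, so it suffices to record
  which values lie in \<open>drop d p\<close>.\<close>

lemma perm_eq_perm_of:
  assumes p: "is_perm p" and s: "sorted (take d p)" "sorted (drop d p)"
  obtains w where "p = perm_of w"
proof -
  have dis: "distinct p" and set: "set p = {1..length p}" using p by (auto simp: is_perm_def)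
  define w where "w = map (\<lambda>i. Suc i \<in> set (drop d p)) [0..<length p]"
  have un: "set (take d p) \<union> set (drop d p) = {1..length p}"
    using set by (metis append_take_drop_id set_append)
  have disj: "set (take d p) \<inter> set (drop d p) = {}"
    using dis by (metis append_take_drop_id distinct_append)
  have x: "x = Suc (x - 1)" "x - 1 < length p" if "x \<in> set p" for x
    using that set by auto
  have srt: "sorted (map Suc (filter P [0..<length p]))" "distinct (map Suc (filter P [0..<length p]))" for P
    by (auto simp: sorted_map distinct_map intro!: sorted_wrt_filter)
  have B: "map Suc (filter (\<lambda>i. Suc i \<in> set (drop d p)) [0..<length p]) = drop d p"
  proof (rule sorted_distinct_set_unique[OF srt s(2)])
    have "x \<in> Suc ` {i. i < length p \<and> Suc i \<in> set (drop d p)}" if "x \<in> set (drop d p)" for x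
      using that x[OF in_set_dropD[OF that]] by (intro image_eqI[of _ _ "x - 1"]) auto
    then show "set (map Suc (filter (\<lambda>i. Suc i \<in> set (drop d p)) [0..<length p])) = set (drop d p)"
      by auto
  qed (use dis in simp)
  have A: "map Suc (filter (\<lambda>i. Suc i \<notin> set (drop d p)) [0..<length p]) = take d p"
  proof (rule sorted_distinct_set_unique[OF srt s(1)])
    have "x \<in> Suc ` {i. i < length p \<and> Suc i \<notin> set (drop d p)}" if "x \<in> set (take d p)" for x
      using that disj x[OF in_set_takeD[OF that]] by (intro image_eqI[of _ _ "x - 1"]) auto
    moreover have "Suc i \<in> set (take d p)" if "i < length p" "Suc i \<notin> set (drop d p)" for i
    proof -
      have "Suc i \<in> set (take d p) \<union> set (drop d p)" unfolding un using that by simp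
      then show ?thesis using that by blast
    qed
    ultimately show "set (map Suc (filter (\<lambda>i. Suc i \<notin> set (drop d p)) [0..<length p])) = set (take d p)"
      by auto
  qed (use dis in simp)
  have "filter (\<lambda>i. \<not> w ! i) [0..<length p] = filter (\<lambda>i. Suc i \<notin> set (drop d p)) [0..<length p]"
    "filter (\<lambda>i. w ! i) [0..<length p] = filter (\<lambda>i. Suc i \<in> set (drop d p)) [0..<length p]"
    by (auto simp: w_def intro!: filter_cong)
  moreover have "length w = length p" by (simp add: w_def)
  ultimately have "perm_of w = map Suc (filter (\<lambda>i. Suc i \<notin> set (drop d p)) [0..<length p]
      @ filter (\<lambda>i. Suc i \<in> set (drop d p)) [0..<length p])"
    by (simp only: perm_of_def)
  also have "\<dots> = p" unfolding map_append A B by simp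
  finally show thesis using that by metis
qed

section \<open>The Moebius function as a number of normal embeddings\<close>

lemma mu_Suc_0: "mu [Suc 0] = 1"
  by (simp add: mu_def)

lemma finite_subseqs: "finite {u. subseq u w \<and> P u}"
proof -
  have "{u. subseq u w \<and> P u} \<subseteq> set (subseqs w)" by auto
  then show ?thesis by (rule finite_subset) simp
qed

lemma contains_1_iff: "contains z [1] \<longleftrightarrow> z \<noteq> []"
proof
  assume "z \<noteq> []"
  then obtain a x where "z = a # x" by (cases z) auto
  then have "order_iso (nths z {0}) [1]" by (simp add: order_iso_def nths_Cons)
  then show "contains z [1]"
    using \<open>z \<noteq> []\<close> unfolding contains_def by (intro exI[of _ "{0}"]) simp
qed (auto simp: contains_def order_iso_def)

lemma subseq_length_less: "subseq u w \<Longrightarrow> u \<noteq> w \<Longrightarrow> length u < length w"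
  using list_emb_length[of "(=)" u w] subseq_same_length[of u w] by linarith

text \<open>The sum is over the image, not over subwords, because several subwords may give the same
  identity, which counts once. Length at least 2 keeps \<open>perm_of w\<close> apart from
  \<open>[1]\<close>.\<close>

lemma mu_perm_of_rec:
  assumes "2 \<le> length w"
  shows "mu (perm_of w) = - (\<Sum>z\<in>perm_of ` {u. subseq u w \<and> u \<noteq> [] \<and> u \<noteq> w}. mu z)"
proof -
  have Z: "{z. is_perm z \<and> length z < length (perm_of w) \<and> contains z [1] \<and> contains (perm_of w) z}
      = perm_of ` {u. subseq u w \<and> u \<noteq> [] \<and> u \<noteq> w}"
  proof (intro set_eqI iffI)
    fix z assume "z \<in> {z. is_perm z \<and> length z < length (perm_of w) \<and> contains z [1] \<and> contains (perm_of w) z}"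
    then have z: "is_perm z" "length z < length w" "z \<noteq> []" "contains (perm_of w) z"
      using contains_1_iff[of z] by simp_all
    then obtain u where u: "subseq u w" "z = perm_of u" using contains_perm_of_iff by blast
    moreover have "u \<noteq> []" using z(3) u(2) by (auto simp: perm_of_def)
    ultimately show "z \<in> perm_of ` {u. subseq u w \<and> u \<noteq> [] \<and> u \<noteq> w}"
      using z(2) by auto
  next
    fix z assume "z \<in> perm_of ` {u. subseq u w \<and> u \<noteq> [] \<and> u \<noteq> w}"
    then obtain u where u: "subseq u w" "u \<noteq> []" "u \<noteq> w" "z = perm_of u" by blast
    then have "z \<noteq> []" by (metis length_0_conv length_perm_of)
    then show "z \<in> {z. is_perm z \<and> length z < length (perm_of w) \<and> contains z [1] \<and> contains (perm_of w) z}"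
      using u contains_perm_of_iff[OF is_perm_perm_of] subseq_length_less[of u w]
        contains_1_iff[of z] is_perm_perm_of[of u] by auto
  qed
  have "length (perm_of w) \<noteq> length []" using assms by auto
  then have ne: "contains (perm_of w) [1]" using contains_1_iff[of "perm_of w"] by metis
  have "length [1] \<noteq> length (perm_of w)" using assms by auto
  then have "[1] \<noteq> perm_of w" by metis
  show ?thesis
    unfolding mu_def using ne \<open>[1] \<noteq> perm_of w\<close> by (subst mob.simps) (simp only: Z if_False if_True simp_thms)
qed

lemma not_descent_word_replicate: "\<not> subseq [True, False] (replicate k b)"
  by (auto simp: subseq_pair_iff)

text \<open>Below an identity there are only shorter identities, one of each length, so the interval
  is a chain. All-False words serve as representatives.\<close>

lemma mu_upt:
  assumes "1 \<le> k"
  shows "mu [1..<Suc k] = (if k = 1 then 1 else if k = 2 then -1 else 0)"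
  using assms
proof (induction k rule: less_induct)
  case (less k)
  show ?case
  proof (cases "k = 1")
    case True
    then show ?thesis by (simp add: mu_Suc_0)
  next
    case False
    let ?w = "replicate k False"
    let ?U = "{u. subseq u ?w \<and> u \<noteq> [] \<and> u \<noteq> ?w}"
    have U: "perm_of u = [1..<Suc (length u)]" "length u < k" "1 \<le> length u" if "u \<in> ?U" for u
    proof -
      have "\<not> subseq [True, False] u"
        using that not_descent_word_replicate subseq_order.order_trans by blast
      then show "perm_of u = [1..<Suc (length u)]" by (rule perm_of_eq_upt)
      show "length u < k" using that subseq_length_less[of u ?w] by simp
      show "1 \<le> length u" using that by (cases u) auto
    qed
    have R: "replicate j False \<in> ?U" "perm_of (replicate j False) = [1..<Suc j]"
      if "1 \<le> j" "j < k" for j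
    proof -
      have "?w = replicate j False @ replicate (k - j) False"
        using that by (simp flip: replicate_add)
      then have "subseq (replicate j False) ?w" by (metis list_emb_prefix subseq_order.order_refl)
      then show "replicate j False \<in> ?U" using that by (auto dest: arg_cong[where f = length])
      show "perm_of (replicate j False) = [1..<Suc j]"
        using perm_of_eq_upt[OF not_descent_word_replicate[of j False]] by simp
    qed
    have Z: "perm_of ` ?U = (\<lambda>j. [1..<Suc j]) ` {1..<k}"
    proof (intro set_eqI iffI)
      fix z assume "z \<in> perm_of ` ?U"
      then obtain u where "u \<in> ?U" "z = perm_of u" by blast
      then show "z \<in> (\<lambda>j. [1..<Suc j]) ` {1..<k}"
        using U[of u] by (intro image_eqI[of _ _ "length u"]) auto
    next
      fix z assume "z \<in> (\<lambda>j. [1..<Suc j]) ` {1..<k}"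
      then obtain j where j: "1 \<le> j" "j < k" "z = [1..<Suc j]" by auto
      then show "z \<in> perm_of ` ?U" using R[OF j(1,2)] by (intro image_eqI[of _ _ "replicate j False"]) simp_all
    qed
    have inj: "inj_on (\<lambda>j. [1..<Suc j]) {1..<k}"
      by (rule inj_on_inverseI[of _ length]) simp
    have "mu [1..<Suc k] = mu (perm_of ?w)"
      using perm_of_eq_upt[OF not_descent_word_replicate[of k False]] by simp
    also have "\<dots> = - (\<Sum>j\<in>{1..<k}. mu [1..<Suc j])"
      using mu_perm_of_rec[of ?w] False less.prems unfolding Z sum.reindex[OF inj] o_def by simp
    also have "(\<Sum>j\<in>{1..<k}. mu [1..<Suc j])
        = (\<Sum>j\<in>{1..<k}. (if j = 1 then 1 else 0) + (if j = 2 then - 1 else 0))"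
    proof (rule sum.cong[OF refl])
      fix j assume "j \<in> {1..<k}"
      then have j: "j < k" "1 \<le> j" by auto
      show "mu [1..<Suc j] = (if j = 1 then 1 else 0) + (if j = 2 then - 1 else 0)"
        unfolding less.IH[OF j] by simp
    qed
    also have "\<dots> = (if k = 2 then 1 else 0)"
      using False less.prems by (simp only: sum.distrib sum.delta finite_atLeastLessThan) auto
    finally show ?thesis using False by simp
  qed
qed

lemma card_nemb_pos_imp_subseq: "0 < card (nemb c v w) \<Longrightarrow> subseq v w"
  by (auto simp: card_gt_0_iff nemb_def subseq_conv_nths)

text \<open>Only the identities of lengths 1 and 2 have nonzero weight. The first always occurs; the
  second occurs unless \<open>w\<close> has length 2, since among three letters of a two-letter
  alphabet two agree.\<close>

lemma sum_mu_below_identities: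
  assumes w: "subseq [True, False] w"
  shows "(\<Sum>z\<in>perm_of ` {u. subseq u w \<and> u \<noteq> [] \<and> u \<noteq> w \<and> \<not> subseq [True, False] u}. mu z)
    = (if w = [True, False] then 1 else 0)"
proof -
  let ?U = "{u. subseq u w \<and> u \<noteq> [] \<and> u \<noteq> w \<and> \<not> subseq [True, False] u}"
  let ?J = "length ` ?U"
  have fin: "finite ?J" by (rule finite_imageI[OF finite_subseqs])
  have inj: "inj_on (\<lambda>j. [1..<Suc j]) ?J"
    by (rule inj_on_inverseI[of _ length]) simp
  have "perm_of ` ?U = (\<lambda>u. [1..<Suc (length u)]) ` ?U"
    using perm_of_eq_upt by (intro image_cong) auto
  then have Z: "perm_of ` ?U = (\<lambda>j. [1..<Suc j]) ` ?J" by (simp only: image_image)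
  have J1: "\<forall>j\<in>?J. 1 \<le> j" by (auto simp: Suc_le_eq)
  have "[True] \<in> ?U"
  proof -
    have "subseq [True] w" using w subseq_order.order_trans[of "[True]" "[True, False]" w] by simp
    then show ?thesis using w by (auto dest: list_emb_length)
  qed
  then have 1: "1 \<in> ?J" by (intro image_eqI[of _ _ "[True]"]) auto
  have 2: "2 \<in> ?J \<longleftrightarrow> w \<noteq> [True, False]"
  proof
    assume "2 \<in> ?J"
    then obtain u where u: "u \<in> ?U" "length u = 2" by (metis (no_types, lifting) imageE)
    then have "length u < length w" using subseq_length_less[of u w] by auto
    then show "w \<noteq> [True, False]" using u by auto
  next
    assume ne: "w \<noteq> [True, False]"
    then have "length w \<ge> 3" using subseq_length_less[OF w] by simp
    then obtain a b c x where abc: "w = a # b # c # x"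
      by (metis Suc_le_length_iff numeral_3_eq_3)
    \<comment> \<open>Pigeonhole: if \<open>a\<close> differs from both \<open>b\<close> and
      \<open>c\<close>, then \<open>b = c\<close>.\<close>
    define y where "y = (if a = b \<or> a = c then a else b)"
    have "subseq [y, y] w" by (auto simp: abc y_def)
    moreover have "\<not> subseq [True, False] [y, y]" by (cases y) auto
    ultimately have "[y, y] \<in> ?U" by (auto simp: abc)
    then show "2 \<in> ?J" by (intro image_eqI[of _ _ "[y, y]"]) auto
  qed
  have "(\<Sum>z\<in>perm_of ` ?U. mu z) = (\<Sum>j\<in>?J. mu [1..<Suc j])"
    unfolding Z sum.reindex[OF inj] o_def ..
  also have "\<dots> = (\<Sum>j\<in>?J. (if j = 1 then 1 else 0) + (if j = 2 then - 1 else 0))"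
  proof (rule sum.cong[OF refl])
    fix j assume "j \<in> ?J"
    then have j: "1 \<le> j" using J1 by blast
    show "mu [1..<Suc j] = (if j = 1 then 1 else 0) + (if j = 2 then - 1 else 0)"
      unfolding mu_upt[OF j] by simp
  qed
  also have "\<dots> = (if w = [True, False] then 1 else 0)"
    using 1 2 by (simp only: sum.distrib sum.delta[OF fin]) auto
  finally show ?thesis .
qed

text \<open>By \<open>signed_nemb_eq\<close> the terms \<open>?f\<close> add up to 1 for
  \<open>w = [True, False]\<close> and to 0 otherwise, exactly the contribution of the identities.
  Substituting the induction hypothesis leaves only \<open>- ?f w\<close>.\<close>

lemma mu_perm_of:
  assumes "subseq [True, False] w"
  shows "mu (perm_of w) = - ((-1) ^ length w * int (card (nemb None [True, False] w)))"
  using assms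
proof (induction "length w" arbitrary: w rule: less_induct)
  case less
  let ?f = "\<lambda>u. (-1) ^ length u * int (card (nemb None [True, False] u))"
  let ?I = "{u. subseq u w \<and> u \<noteq> [] \<and> u \<noteq> w \<and> \<not> subseq [True, False] u}"
  let ?N = "{u. subseq u w \<and> u \<noteq> w \<and> subseq [True, False] u}"
  have len: "2 \<le> length w" using less.prems by (auto dest: list_emb_length)
  have U: "{u. subseq u w \<and> u \<noteq> [] \<and> u \<noteq> w} = ?I \<union> ?N" by auto
  have disj: "perm_of ` ?I \<inter> perm_of ` ?N = {}"
  proof -
    have "sorted z" if "z \<in> perm_of ` ?I" for z using that sorted_perm_of_iff by blast
    moreover have "\<not> sorted z" if "z \<in> perm_of ` ?N" for z using that sorted_perm_of_iff by blast
    ultimately show ?thesis by blast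
  qed
  have "(\<Sum>z\<in>perm_of ` ?N. mu z) = (\<Sum>u\<in>?N. mu (perm_of u))"
    by (subst sum.reindex) (auto intro!: inj_onI perm_of_inj)
  also have "\<dots> = (\<Sum>u\<in>?N. - ?f u)"
    using less.hyps subseq_length_less by (intro sum.cong) auto
  finally have N: "(\<Sum>z\<in>perm_of ` ?N. mu z) = - (\<Sum>u\<in>?N. ?f u)" by (simp add: sum_negf)
  have "(\<Sum>u | subseq u w. ?f u) = (\<Sum>u\<in>insert w ?N. ?f u)"
    using finite_subseqs[of w "\<lambda>_. True"] less.prems
    by (intro sum.mono_neutral_right) (auto dest: card_nemb_pos_imp_subseq)
  also have "\<dots> = ?f w + (\<Sum>u\<in>?N. ?f u)"
    by (subst sum.insert) (auto simp: finite_subseqs)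
  finally have S: "(if w = [True, False] then 1 else 0) = ?f w + (\<Sum>u\<in>?N. ?f u)"
    using conjunct1[OF signed_nemb_eq, of "[True, False]" w] by (auto simp: signed_nemb_def)
  have "mu (perm_of w) = - ((\<Sum>z\<in>perm_of ` ?I. mu z) + (\<Sum>z\<in>perm_of ` ?N. mu z))"
    unfolding mu_perm_of_rec[OF len] U image_Un
    by (subst sum.union_disjoint[OF _ _ disj]) (auto simp: finite_subseqs)
  then show ?case
    unfolding N sum_mu_below_identities[OF less.prems] S by simp
qed

section \<open>Normal embeddings as pairs of positions, repetitions as adjacency pairs\<close>

definition normal_pairs :: "bool list \<Rightarrow> (nat \<times> nat) set" where
  "normal_pairs w = {(i, j). i < j \<and> j < length w \<and> w ! i \<and> \<not> w ! j \<and> reps None w \<subseteq> {i, j}}"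

lemma card_nemb_pair: "card (nemb None [True, False] w) = card (normal_pairs w)"
proof -
  have "bij_betw (\<lambda>(i, j). {i, j}) (normal_pairs w) (nemb None [True, False] w)"
  proof (intro bij_betw_imageI)
    show "inj_on (\<lambda>(i, j). {i, j}) (normal_pairs w)"
      by (auto simp: inj_on_def normal_pairs_def doubleton_eq_iff)
    show "(\<lambda>(i, j). {i, j}) ` normal_pairs w = nemb None [True, False] w"
    proof
      show "(\<lambda>(i, j). {i, j}) ` normal_pairs w \<subseteq> nemb None [True, False] w"
        by (auto simp: normal_pairs_def nemb_def nths_pair)
      show "nemb None [True, False] w \<subseteq> (\<lambda>(i, j). {i, j}) ` normal_pairs w"
      proof
        fix I assume I: "I \<in> nemb None [True, False] w"
        then have "nths w I = [True, False]" "I \<subseteq> {..<length w}" by (auto simp: nemb_def)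
        then obtain i j where "i < j" "j < length w" "I = {i, j}" "w ! i = True" "w ! j = False"
          by (rule nths_eq_pairE)
        then show "I \<in> (\<lambda>(i, j). {i, j}) ` normal_pairs w"
          using I by (intro image_eqI[of _ _ "(i, j)"]) (auto simp: normal_pairs_def nemb_def)
      qed
    qed
  qed
  then show ?thesis by (simp add: bij_betw_same_card)
qed

lemma reps_None: "i \<in> reps None w \<longleftrightarrow> 0 < i \<and> i < length w \<and> w ! (i - 1) = w ! i"
  by (cases i) (auto simp: reps_def)

text \<open>A True before a False is an entry of the second run smaller than one of the first. The
  head of the second run is no larger than the former, the end of the first run no smaller than the
  latter.\<close>

lemma descent_at_first_run:
  assumes "subseq [True, False] w"
  shows "0 < first_run w" "first_run w < length w"
    "perm_of w ! first_run w < perm_of w ! (first_run w - 1)"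
proof -
  let ?d = "first_run w"
  obtain i j where ij: "i < j" "j < length w" "w ! i" "\<not> w ! j"
    using assms by (auto simp: subseq_pair_iff)
  obtain k where k: "k < length w" "perm_of w ! k = Suc i" using perm_of_value[of i w] ij by auto
  obtain l where l: "l < length w" "perm_of w ! l = Suc j" using perm_of_value[of j w] ij by auto
  have d: "?d \<le> k" "l < ?d"
    using perm_of_nth_letter[OF k(1)] perm_of_nth_letter[OF l(1)] k l ij by auto
  then show d': "0 < ?d" "?d < length w" using k by auto
  have "perm_of w ! ?d \<le> perm_of w ! k"
    using perm_of_increasing[of ?d k w] d k by (cases "?d = k") auto
  moreover have "perm_of w ! l \<le> perm_of w ! (?d - 1)"
    using perm_of_increasing[of l "?d - 1" w] d d' by (cases "l = ?d - 1") (auto intro: less_imp_le)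
  ultimately show "perm_of w ! ?d < perm_of w ! (?d - 1)" using k l ij by simp
qed

text \<open>An adjacency pair cannot straddle the descent, so its two values carry equal letters;
  conversely, consecutive values in one increasing run are neighbours. With 1-based
  \<open>i\<close>, the larger value of the pair is \<open>perm_of w ! i\<close>, and subtracting 1
  gives the index of its letter.\<close>

lemma bij_betw_adjs_reps:
  assumes "subseq [True, False] w"
  shows "bij_betw (\<lambda>i. perm_of w ! i - 1) (adjs (perm_of w)) (reps None w)"
proof (intro bij_betw_imageI)
  let ?p = "perm_of w" and ?d = "first_run w"
  have pos: "0 < ?p ! i" if "i < length w" for i
    using nth_mem[of i ?p] that set_perm_of[of w] by auto
  show "inj_on (\<lambda>i. ?p ! i - 1) (adjs ?p)"
  proof (rule inj_onI)
    fix i j assume ij: "i \<in> adjs ?p" "j \<in> adjs ?p" "?p ! i - 1 = ?p ! j - 1"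
    then have l: "i < length w" "j < length w" by (auto simp: adjs_def)
    then have "?p ! i = ?p ! j" using ij(3) pos[of i] pos[of j] by simp
    then show "i = j" using nth_eq_iff_index_eq[OF distinct_perm_of, of i w j] l by simp
  qed
  show "(\<lambda>i. ?p ! i - 1) ` adjs ?p = reps None w"
  proof (intro set_eqI iffI)
    fix r assume "r \<in> (\<lambda>i. ?p ! i - 1) ` adjs ?p"
    then obtain i where i: "1 \<le> i" "i < length w" "?p ! i = ?p ! (i - 1) + 1" "r = ?p ! i - 1"
      by (auto simp: adjs_def)
    have "i \<noteq> ?d" using i descent_at_first_run(3)[OF assms] by auto
    then have "w ! (?p ! i - 1) = w ! (?p ! (i - 1) - 1)"
      using perm_of_nth_letter[of i w] perm_of_nth_letter[of "i - 1" w] i by auto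
    moreover have "?p ! i \<le> length w" using nth_mem[of i ?p] set_perm_of[of w] i(2) by auto
    ultimately show "r \<in> reps None w"
      using i pos[of "i - 1"] by (auto simp: reps_None)
  next
    fix r assume "r \<in> reps None w"
    then have r: "0 < r" "r < length w" "w ! (r - 1) = w ! r" by (auto simp: reps_None)
    obtain i where i: "i < length w" "?p ! i = Suc r" using perm_of_value[OF r(2)] .
    obtain k where k: "k < length w" "?p ! k = r" using perm_of_value[of "r - 1" w] r
      by (metis Suc_diff_1 less_imp_diff_less)
    have same: "?d \<le> i \<longleftrightarrow> ?d \<le> k"
      using perm_of_nth_letter[OF i(1)] perm_of_nth_letter[OF k(1)] i k r by simp
    have "k < i" using perm_of_increasing[of i k w] i k same by (cases i k rule: linorder_cases) auto
    \<comment> \<open>An entry in between would lie strictly between \<open>r\<close> and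
      \<open>Suc r\<close>.\<close>
    moreover have "\<not> Suc k < i"
      using perm_of_increasing[of k "Suc k" w] perm_of_increasing[of "Suc k" i w] i k same by auto
    ultimately have "i = Suc k" by simp
    then have "i \<in> adjs ?p" using i k by (simp add: adjs_def)
    then show "r \<in> (\<lambda>i. ?p ! i - 1) ` adjs ?p" using i by (intro image_eqI[of _ _ i]) auto
  qed
qed

section \<open>Counting normal embeddings\<close>

lemma card_strict_pairs: "card {(a, b). a < b \<and> b < (m::nat)} = m choose 2"
proof (induction m)
  case (Suc m)
  have "{(a, b). a < b \<and> b < Suc m} = {(a, b). a < b \<and> b < m} \<union> (\<lambda>a. (a, m)) ` {..<m}"
    by auto
  moreover have "finite {(a, b). a < b \<and> b < m}"
    by (rule finite_subset[of _ "{..<m} \<times> {..<m}"]) auto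
  ultimately have "card {(a, b). a < b \<and> b < Suc m}
      = card {(a, b). a < b \<and> b < m} + card ((\<lambda>a. (a, m)) ` {..<m})"
    by (simp only:) (rule card_Un_disjoint, auto)
  also have "card ((\<lambda>a. (a, m)) ` {..<m}) = m" by (subst card_image) (auto simp: inj_on_def)
  finally show ?case using Suc by (simp add: numeral_2_eq_2)
qed simp

lemma card_odd_even_pairs:
  "card {(i, j). i < j \<and> j < n \<and> odd i \<and> even (j::nat)} = ((n + 1) div 2) choose 2"
proof -
  let ?P = "{(a, b). a < b \<and> b < (n + 1) div 2}"
  have "{(i, j). i < j \<and> j < n \<and> odd i \<and> even j} = (\<lambda>(a, b). (2 * a + 1, 2 * b)) ` ?P"
  proof (intro set_eqI iffI)
    fix x assume "x \<in> {(i, j). i < j \<and> j < n \<and> odd i \<and> even j}"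
    then obtain a b where "x = (2 * a + 1, 2 * b)" "2 * a + 1 < 2 * b" "2 * b < n"
      by (auto elim!: oddE evenE)
    then show "x \<in> (\<lambda>(a, b). (2 * a + 1, 2 * b)) ` ?P"
      by (intro image_eqI[of _ _ "(a, b)"]) auto
  qed auto
  moreover have "inj_on (\<lambda>(a, b). (2 * a + 1, 2 * b)) ?P" by (auto simp: inj_on_def)
  ultimately show ?thesis by (simp add: card_image card_strict_pairs)
qed

text \<open>Writing the odd coordinate as \<open>2 * b - 1\<close> turns \<open>i < j\<close> into
  \<open>a < b\<close>; this also forces \<open>b > 0\<close>, so the subtraction is not
  truncated.\<close>

lemma card_even_odd_pairs:
  "card {(i, j). i < j \<and> j < n \<and> even i \<and> odd (j::nat)} = (n div 2 + 1) choose 2"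
proof -
  let ?P = "{(a, b). a < b \<and> b < n div 2 + 1}"
  have "{(i, j). i < j \<and> j < n \<and> even i \<and> odd j} = (\<lambda>(a, b). (2 * a, 2 * b - 1)) ` ?P"
  proof (intro set_eqI iffI)
    fix x assume "x \<in> {(i, j). i < j \<and> j < n \<and> even i \<and> odd j}"
    then obtain a b where "x = (2 * a, 2 * b + 1)" "2 * a < 2 * b + 1" "2 * b + 1 < n"
      by (auto elim!: oddE evenE)
    then show "x \<in> (\<lambda>(a, b). (2 * a, 2 * b - 1)) ` ?P"
      by (intro image_eqI[of _ _ "(a, b + 1)"]) auto
  next
    fix x assume "x \<in> (\<lambda>(a, b). (2 * a, 2 * b - 1)) ` ?P"
    then obtain a b where "x = (2 * a, 2 * b - 1)" "a < b" "b < n div 2 + 1" by auto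
    then show "x \<in> {(i, j). i < j \<and> j < n \<and> even i \<and> odd j}" by auto
  qed
  moreover have "inj_on (\<lambda>(a, b). (2 * a, 2 * b - 1)) ?P" by (auto simp: inj_on_def)
  ultimately show ?thesis by (simp add: card_image card_strict_pairs)
qed

lemma alternating_letters:
  assumes "reps None w = {}" "k < length w"
  shows "w ! k \<longleftrightarrow> (w ! 0 \<noteq> odd k)"
  using assms(2)
proof (induction k)
  case (Suc k)
  have "Suc k \<notin> reps None w" using assms(1) by simp
  then have "w ! Suc k \<noteq> w ! k" using Suc.prems by (simp add: reps_None)
  then show ?case using Suc by simp
qed simp

lemma card_normal_pairs_alternating:
  assumes "reps None w = {}"
  shows "card (normal_pairs w) =
    (if w ! 0 then (length w div 2 + 1) choose 2 else ((length w + 1) div 2) choose 2)"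
proof -
  have "normal_pairs w = (if w ! 0 then {(i, j). i < j \<and> j < length w \<and> even i \<and> odd j}
      else {(i, j). i < j \<and> j < length w \<and> odd i \<and> even j})"
    using alternating_letters[OF assms] assms by (auto simp: normal_pairs_def)
  then show ?thesis by (simp add: card_odd_even_pairs card_even_odd_pairs)
qed

text \<open>The repeated False must be the second position of the pair, so the Trues before
  \<open>r\<close> are counted. Each is directly followed by a False before \<open>r\<close>, and
  only a False at position 0 is missed. Falses are the useful count because they are the entries of
  the first run.\<close>

lemma card_normal_pairs_one_False:
  assumes "reps None w = {r}" "\<not> w ! r"
  shows "card (normal_pairs w) = card {j. j < r \<and> \<not> w ! j} - (if w ! 0 then 0 else 1)"
proof -
  have r: "0 < r" "r < length w" "\<not> w ! (r - 1)" using assms reps_None[of r w] by auto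
  have alt: "w ! j \<noteq> w ! (j - 1)" if "0 < j" "j < r" for j
  proof -
    have "j \<notin> reps None w" using assms(1) that by simp
    then show ?thesis using that r by (auto simp: reps_None)
  qed
  have eq: "Suc ` {i. i < r \<and> w ! i} = {j. j < r \<and> \<not> w ! j} - {0}"
  proof (intro set_eqI iffI)
    fix j assume "j \<in> Suc ` {i. i < r \<and> w ! i}"
    then obtain i where i: "i < r" "w ! i" "j = Suc i" by auto
    then have "i \<noteq> r - 1" using r by auto
    then show "j \<in> {j. j < r \<and> \<not> w ! j} - {0}" using i alt[of j] by auto
  next
    fix j assume j: "j \<in> {j. j < r \<and> \<not> w ! j} - {0}"
    then show "j \<in> Suc ` {i. i < r \<and> w ! i}"
      using alt[of j] by (intro image_eqI[of _ _ "j - 1"]) auto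
  qed
  have "normal_pairs w = (\<lambda>i. (i, r)) ` {i. i < r \<and> w ! i}"
    using assms r by (auto simp: normal_pairs_def)
  then have "card (normal_pairs w) = card {i. i < r \<and> w ! i}"
    by (simp add: card_image inj_on_def)
  also have "\<dots> = card (Suc ` {i. i < r \<and> w ! i})" by (simp add: card_image)
  also have "\<dots> = card {j. j < r \<and> \<not> w ! j} - (if w ! 0 then 0 else 1)"
    unfolding eq using r by (simp add: card_Diff_singleton_if)
  finally show ?thesis .
qed

text \<open>Mirror image: the repeated True must come first in the pair, and each False after
  \<open>r\<close> directly follows a True at or after \<open>r\<close>. Only a True in the last
  position has no such successor.\<close>

lemma card_normal_pairs_one_True:
  assumes "reps None w = {r}" "w ! r"
  shows "card (normal_pairs w) =
    card {k. r \<le> k \<and> k < length w \<and> w ! k} - (if w ! (length w - 1) then 1 else 0)"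
proof -
  let ?n = "length w"
  have r: "0 < r" "r < ?n" "w ! (r - 1)" using assms reps_None[of r w] by auto
  have alt: "w ! j \<noteq> w ! (j - 1)" if "r < j" "j < ?n" for j
  proof -
    have "j \<notin> reps None w" using assms(1) that by simp
    then show ?thesis using that r by (auto simp: reps_None)
  qed
  have eq: "Suc ` ({k. r \<le> k \<and> k < ?n \<and> w ! k} - {?n - 1}) = {j. r < j \<and> j < ?n \<and> \<not> w ! j}"
  proof (intro set_eqI iffI)
    fix j assume "j \<in> Suc ` ({k. r \<le> k \<and> k < ?n \<and> w ! k} - {?n - 1})"
    then obtain k where "r \<le> k" "k < ?n" "w ! k" "k \<noteq> ?n - 1" "j = Suc k" by auto
    then show "j \<in> {j. r < j \<and> j < ?n \<and> \<not> w ! j}" using alt[of j] by auto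
  next
    fix j assume j: "j \<in> {j. r < j \<and> j < ?n \<and> \<not> w ! j}"
    then show "j \<in> Suc ` ({k. r \<le> k \<and> k < ?n \<and> w ! k} - {?n - 1})"
      using alt[of j] by (intro image_eqI[of _ _ "j - 1"]) auto
  qed
  have "normal_pairs w = Pair r ` {j. r < j \<and> j < ?n \<and> \<not> w ! j}"
    using assms r by (auto simp: normal_pairs_def)
  then have "card (normal_pairs w) = card {j. r < j \<and> j < ?n \<and> \<not> w ! j}"
    by (simp add: card_image inj_on_def)
  also have "\<dots> = card ({k. r \<le> k \<and> k < ?n \<and> w ! k} - {?n - 1})"
    unfolding eq[symmetric] by (simp add: card_image)
  also have "\<dots> = card {k. r \<le> k \<and> k < ?n \<and> w ! k} - (if w ! (?n - 1) then 1 else 0)"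
    using r by (simp add: card_Diff_singleton_if)
  finally show ?thesis .
qed

lemma perm_of_pos: "i < length w \<Longrightarrow> 0 < perm_of w ! i"
  using nth_mem[of i "perm_of w"] set_perm_of[of w] by auto

lemma perm_of_le: "i < length w \<Longrightarrow> perm_of w ! i \<le> length w"
  using nth_mem[of i "perm_of w"] set_perm_of[of w] by auto

lemma inj_on_perm_of: "A \<subseteq> {..<length w} \<Longrightarrow> inj_on (\<lambda>k. perm_of w ! k - 1) A"
proof (rule inj_onI)
  fix i j assume ij: "A \<subseteq> {..<length w}" "i \<in> A" "j \<in> A" "perm_of w ! i - 1 = perm_of w ! j - 1"
  then have l: "i < length w" "j < length w" by auto
  then have "perm_of w ! i = perm_of w ! j" using ij(4) perm_of_pos[of i w] perm_of_pos[of j w] by simp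
  then show "i = j" using nth_eq_iff_index_eq[OF distinct_perm_of, of i w j] l by simp
qed

text \<open>The first run increases, so its values below \<open>Suc r\<close> are those at the
  \<open>i\<close> positions before it.\<close>

lemma card_False_before:
  assumes "i < first_run w" "perm_of w ! i = Suc r"
  shows "card {j. j < r \<and> \<not> w ! j} = i"
proof -
  have i: "i < length w" using assms first_run_le[of w] by simp
  have r: "r < length w" using perm_of_le[OF i] assms by simp
  have "(\<lambda>k. perm_of w ! k - 1) ` {..<i} = {j. j < r \<and> \<not> w ! j}"
  proof (intro set_eqI iffI)
    fix j assume "j \<in> (\<lambda>k. perm_of w ! k - 1) ` {..<i}"
    then obtain k where "k < i" "j = perm_of w ! k - 1" by auto
    then show "j \<in> {j. j < r \<and> \<not> w ! j}"
      using perm_of_increasing[of k i w] perm_of_nth_letter[of k w] perm_of_pos[of k w] assms i by auto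
  next
    fix j assume j: "j \<in> {j. j < r \<and> \<not> w ! j}"
    then obtain k where k: "k < length w" "perm_of w ! k = Suc j" using perm_of_value[of j w] r by auto
    then have "k < first_run w" using perm_of_nth_letter[of k w] j by auto
    then have "k < i"
      using perm_of_increasing[of i k w] j k assms by (cases i k rule: linorder_cases) auto
    then show "j \<in> (\<lambda>k. perm_of w ! k - 1) ` {..<i}"
      using k by (intro image_eqI[of _ _ k]) auto
  qed
  then show ?thesis
    using card_image[OF inj_on_perm_of[of "{..<i}" w]] i by (simp add: subset_iff)
qed

lemma card_True_from:
  assumes "first_run w \<le> i" "i < length w" "perm_of w ! i = Suc r"
  shows "card {k. r \<le> k \<and> k < length w \<and> w ! k} = length w - i"
proof -
  have "(\<lambda>k. perm_of w ! k - 1) ` {i..<length w} = {k. r \<le> k \<and> k < length w \<and> w ! k}"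
  proof (intro set_eqI iffI)
    fix j assume "j \<in> (\<lambda>k. perm_of w ! k - 1) ` {i..<length w}"
    then obtain k where k: "i \<le> k" "k < length w" "j = perm_of w ! k - 1" by auto
    moreover have "perm_of w ! i \<le> perm_of w ! k"
      using perm_of_increasing[of i k w] assms k by (cases "i = k") auto
    ultimately show "j \<in> {k. r \<le> k \<and> k < length w \<and> w ! k}"
      using perm_of_nth_letter[of k w] perm_of_le[of k w] assms by auto
  next
    fix j assume j: "j \<in> {k. r \<le> k \<and> k < length w \<and> w ! k}"
    then obtain k where k: "k < length w" "perm_of w ! k = Suc j" using perm_of_value[of j w] by auto
    then have "first_run w \<le> k" using perm_of_nth_letter[of k w] j by auto
    then have "i \<le> k"
      using perm_of_increasing[of k i w] j k assms by (cases i k rule: linorder_cases) auto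
    then show "j \<in> (\<lambda>k. perm_of w ! k - 1) ` {i..<length w}"
      using k by (intro image_eqI[of _ _ k]) auto
  qed
  then show ?thesis
    using card_image[OF inj_on_perm_of[of "{i..<length w}" w]] by (simp add: subset_iff)
qed

section \<open>The cases of the theorem\<close>

lemma single_descent_perm_of:
  assumes p: "is_perm p" and d: "descents p = {d}"
  obtains w where "p = perm_of w" "subseq [True, False] w" "first_run w = d"
proof -
  have d0: "1 \<le> d" "d < length p" "p ! d < p ! (d - 1)" using d by (auto simp: descents_def)
  have asc: "p ! k \<le> p ! Suc k" if "Suc k < length p" "Suc k \<noteq> d" for k
  proof -
    have "Suc k \<notin> descents p" using d that by simp
    then show ?thesis using that by (auto simp: descents_def)
  qed
  have "sorted (take d p)" "sorted (drop d p)"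
    using asc d0 by (auto simp: sorted_iff_nth_Suc)
  then obtain w where w: "p = perm_of w" using perm_eq_perm_of p by metis
  have desc: "subseq [True, False] w"
    using d0 sorted_perm_of_iff[of w] sorted_nth_mono[of p "d - 1" d] unfolding w by fastforce
  then have "first_run w \<in> descents p"
    using descent_at_first_run[of w] unfolding w by (auto simp: descents_def)
  then show thesis using that[OF w desc] d by simp
qed

theorem mainTheorem10:
  fixes p :: "nat list" and n :: nat
  assumes perm: "is_perm p" and len: "length p = n" and n2: "n > 2"
    and onedes: "card (descents p) = 1"
  shows
   "(mu p \<noteq> 0 \<longrightarrow> (mu p > 0 \<longleftrightarrow> odd n))
  \<and> ((p ! 0 = 1 \<and> p ! 1 = 2) \<or> (p ! (n - 2) = n - 1 \<and> p ! (n - 1) = n) \<longrightarrow> mu p = 0)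
  \<and> (has_triple_adj p \<longrightarrow> mu p = 0)
  \<and> (card (adjs p) > 2 \<longrightarrow> mu p = 0)
  \<and> (\<forall>i j. adjs p = {i, j} \<and> i < j \<longrightarrow>
        (p ! (i - 1) > p ! (j - 1) \<longrightarrow> \<bar>mu p\<bar> = 1)
      \<and> (p ! (i - 1) < p ! (j - 1) \<longrightarrow> mu p = 0))
  \<and> (\<forall>i d. adjs p = {i} \<and> descents p = {d} \<longrightarrow>
        (i < d \<and> p ! 0 \<noteq> 1 \<longrightarrow> \<bar>mu p\<bar> = int i)
      \<and> (i < d \<and> p ! 0 = 1 \<longrightarrow> \<bar>mu p\<bar> = int i - 1)
      \<and> (i > d \<and> p ! (n - 1) \<noteq> n \<longrightarrow> \<bar>mu p\<bar> = int n - int i)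
      \<and> (i > d \<and> p ! (n - 1) = n \<longrightarrow> \<bar>mu p\<bar> = int n - int i - 1))
  \<and> (adjs p = {} \<longrightarrow>
        (even n \<and> p ! 0 = 1 \<longrightarrow> mu p = - int ((n div 2) choose 2))
      \<and> (even n \<and> p ! 0 = 2 \<longrightarrow> mu p = - int ((n div 2 + 1) choose 2))
      \<and> (odd n \<longrightarrow> mu p = int (((n + 1) div 2) choose 2)))"
proof -
  obtain d where d: "descents p = {d}" using onedes by (auto simp: card_1_singleton_iff)
  obtain w where w: "p = perm_of w" "subseq [True, False] w" "first_run w = d"
    using single_descent_perm_of[OF perm d] .
  have n: "length w = n" using len w by simp
  have d0: "0 < d" "d < n" using descent_at_first_run[OF w(2)] w n by auto
  let ?c = "card (normal_pairs w)"
  have mu: "mu p = - ((-1) ^ n * int ?c)"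
    using mu_perm_of[OF w(2)] by (simp add: w(1) n card_nemb_pair)
  have absmu: "\<bar>mu p\<bar> = int ?c" unfolding mu by (simp add: abs_mult)
  have zero: "mu p = 0" if "normal_pairs w = {}" unfolding mu using that by simp
  have letter: "w ! (p ! k - 1) \<longleftrightarrow> d \<le> k" if "k < n" for k
    using perm_of_nth_letter[of k w] that w n by simp
  have inc: "p ! k < p ! l" if "k < l" "l < n" "l < d \<or> d \<le> k" for k l
    using perm_of_increasing[of k l w] that w n by simp
  have bij: "bij_betw (\<lambda>i. p ! i - 1) (adjs p) (reps None w)"
    using bij_betw_adjs_reps[OF w(2)] w(1) by simp
  then have reps: "reps None w = (\<lambda>i. p ! i - 1) ` adjs p" by (simp add: bij_betw_imp_surj_on)
  have pos: "0 < p ! k" "p ! k \<le> n" if "k < n" for k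
    using perm_of_pos[of k w] perm_of_le[of k w] that w n by auto
  \<comment> \<open>\<open>w ! 0\<close> is the letter of the value 1, which heads the first run if
    it lies there.\<close>
  have first: "w ! 0 \<longleftrightarrow> p ! 0 \<noteq> 1"
  proof (cases "w ! 0")
    case True
    then show ?thesis using letter[of 0] d0 n2 by auto
  next
    case False
    obtain k where k: "k < n" "p ! k = Suc 0" using perm_of_value[of 0 w] w n n2 by auto
    then have "k < d" using letter[of k] False by auto
    then have "k = 0" using inc[of 0 k] k pos[of 0] d0 by (cases "k = 0") auto
    then show ?thesis using k False by simp
  qed
  have last: "w ! (n - 1) \<longleftrightarrow> p ! (n - 1) = n"
  proof (cases "w ! (n - 1)")
    case False
    then show ?thesis using letter[of "n - 1"] d0 n2 by auto
  next
    case True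
    obtain k where k: "k < n" "p ! k = n" using perm_of_value[of "n - 1" w] w n n2 by auto
    then have "d \<le> k" using letter[of k] True by auto
    have "k = n - 1"
    proof (rule ccontr)
      assume "k \<noteq> n - 1"
      then have "k < n - 1" using k by simp
      then have "p ! k < p ! (n - 1)" using inc[of k "n - 1"] \<open>d \<le> k\<close> n2 by simp
      then show False using k(2) pos(2)[of "n - 1"] n2 by simp
    qed
    then show ?thesis using k True by simp
  qed
  have sign: "mu p \<noteq> 0 \<longrightarrow> (mu p > 0 \<longleftrightarrow> odd n)"
    unfolding mu by (cases "even n") auto
  have ends: "mu p = 0"
    if "(p ! 0 = 1 \<and> p ! 1 = 2) \<or> (p ! (n - 2) = n - 1 \<and> p ! (n - 1) = n)"
    using that
  proof
    assume a: "p ! 0 = 1 \<and> p ! 1 = 2"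
    then have "1 \<in> adjs p" using len n2 by (simp add: adjs_def)
    then have "p ! 1 - 1 \<in> reps None w" unfolding reps by blast
    then have r: "1 \<in> reps None w" using a by simp
    then have "\<not> w ! 1" "\<not> w ! 0" using a first by (auto simp: reps_None)
    \<comment> \<open>The repeated False at 1 must be the second position, but the only position
      before it carries False too.\<close>
    then have "normal_pairs w = {}" using r by (auto simp: normal_pairs_def)
    then show ?thesis by (rule zero)
  next
    assume a: "p ! (n - 2) = n - 1 \<and> p ! (n - 1) = n"
    have "n - 1 - 1 = n - 2" by simp
    then have "n - 1 \<in> adjs p" using a len n2 by (simp add: adjs_def)
    then have "p ! (n - 1) - 1 \<in> reps None w" unfolding reps by blast
    then have r: "n - 1 \<in> reps None w" using a by simp
    have "w ! (n - 1)" using a last by simp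
    \<comment> \<open>The repeated True in the last position must come first in the pair, with no
      room for a second position.\<close>
    then have "normal_pairs w = {}" using r n by (auto simp: normal_pairs_def)
    then show ?thesis by (rule zero)
  qed
  have triple: "mu p = 0" if t: "has_triple_adj p"
  proof -
    obtain i where i: "1 \<le> i" "i + 2 \<le> n" "p ! i = p ! (i - 1) + 1" "p ! (i + 1) = p ! (i - 1) + 2"
      using t unfolding has_triple_adj_def len by blast
    let ?r = "p ! i - 1"
    have "i \<in> adjs p" "i + 1 \<in> adjs p" using i len by (auto simp: adjs_def)
    then have "?r \<in> reps None w" "p ! (i + 1) - 1 \<in> reps None w" unfolding reps by blast+
    moreover have "p ! (i + 1) - 1 = Suc ?r" using i by simp
    ultimately have r: "?r \<in> reps None w" "Suc ?r \<in> reps None w" by auto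
    have same: "w ! Suc ?r = w ! ?r" using r(2) reps_None[of "Suc ?r" w] by simp
    \<comment> \<open>The two neighbouring repetitions exhaust the pair, yet carry the same
      letter.\<close>
    have False if "(a, b) \<in> normal_pairs w" for a b
    proof -
      have ab: "?r \<in> {a, b}" "Suc ?r \<in> {a, b}" "w ! a" "\<not> w ! b"
        using that r unfolding normal_pairs_def by blast+
      then have "{?r, Suc ?r} = {a, b}" by auto
      then show False using ab same by (auto simp: doubleton_eq_iff)
    qed
    then have "normal_pairs w = {}" by auto
    then show ?thesis by (rule zero)
  qed
  have many: "mu p = 0" if "card (adjs p) > 2"
  proof -
    have c: "card (reps None w) > 2" using that bij_betw_same_card[OF bij] by simp
    have "\<not> reps None w \<subseteq> {i, j}" for i j
    proof
      assume "reps None w \<subseteq> {i, j}"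
      then have "card (reps None w) \<le> card {i, j}" by (intro card_mono) auto
      also have "\<dots> \<le> 2" by (simp add: card_insert_if)
      finally show False using c by simp
    qed
    then have "normal_pairs w = {}" by (auto simp: normal_pairs_def)
    then show ?thesis by (rule zero)
  qed
  have two: "(p ! (i - 1) > p ! (j - 1) \<longrightarrow> \<bar>mu p\<bar> = 1) \<and> (p ! (i - 1) < p ! (j - 1) \<longrightarrow> mu p = 0)"
    if "adjs p = {i, j}" "i < j" for i j
  proof -
    have ij: "1 \<le> i" "i < j" "j < n" "p ! i = p ! (i - 1) + 1" "p ! j = p ! (j - 1) + 1"
    proof -
      have "i \<in> adjs p" "j \<in> adjs p" using that by auto
      then show "1 \<le> i" "i < j" "j < n" "p ! i = p ! (i - 1) + 1" "p ! j = p ! (j - 1) + 1"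
        using that len by (auto simp: adjs_def)
    qed
    define r s where "r = p ! i - 1" and "s = p ! j - 1"
    have R: "reps None w = {r, s}" unfolding reps that r_def s_def by simp
    have lr: "w ! r \<longleftrightarrow> d \<le> i" "w ! s \<longleftrightarrow> d \<le> j" using letter[of i] letter[of j] ij by (auto simp: r_def s_def)
    have rs: "p ! (i - 1) = r" "p ! (j - 1) = s" using ij by (auto simp: r_def s_def)
    have sn: "r < n" "s < n" using pos[of i] pos[of j] ij by (auto simp: r_def s_def)
    show ?thesis
    proof (intro conjI impI)
      assume gt: "p ! (i - 1) > p ! (j - 1)"
      \<comment> \<open>Within one run the later pair would have the larger value. So the pairs lie
        on different sides of the descent, and \<open>(s, r)\<close> carries the letters True,
        False.\<close>
      have "\<not> (j < d \<or> d \<le> i)"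
      proof
        assume "j < d \<or> d \<le> i"
        then have "p ! i < p ! j" by (rule inc[OF ij(2,3)])
        then show False using gt ij by simp
      qed
      then have "i < d" "d \<le> j" by auto
      then have "normal_pairs w = {(s, r)}"
        using gt[unfolded rs] lr sn n by (auto simp: normal_pairs_def R)
      then show "\<bar>mu p\<bar> = 1" unfolding absmu by simp
    next
      assume "p ! (i - 1) < p ! (j - 1)"
      then have "r < s" unfolding rs .
      \<comment> \<open>Only \<open>(r, s)\<close> is possible, and its letters would need
        \<open>d \<le> i\<close> and \<open>j < d\<close>, against \<open>i < j\<close>.\<close>
      then have "normal_pairs w = {}"
        using lr ij by (auto simp: normal_pairs_def R)
      then show "mu p = 0" by (rule zero)
    qed
  qed
  have one: "(i < d' \<and> p ! 0 \<noteq> 1 \<longrightarrow> \<bar>mu p\<bar> = int i)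
      \<and> (i < d' \<and> p ! 0 = 1 \<longrightarrow> \<bar>mu p\<bar> = int i - 1)
      \<and> (i > d' \<and> p ! (n - 1) \<noteq> n \<longrightarrow> \<bar>mu p\<bar> = int n - int i)
      \<and> (i > d' \<and> p ! (n - 1) = n \<longrightarrow> \<bar>mu p\<bar> = int n - int i - 1)"
    if "adjs p = {i}" "descents p = {d'}" for i d'
  proof -
    have d': "d' = d" using that d by simp
    have "i \<in> adjs p" using that by simp
    then have i: "1 \<le> i" "i < n" using len by (auto simp: adjs_def)
    define r where "r = p ! i - 1"
    have R: "reps None w = {r}" unfolding reps that r_def by simp
    have pr: "perm_of w ! i = Suc r" using pos[of i] i w by (simp add: r_def)
    have lr: "w ! r \<longleftrightarrow> d \<le> i" using letter[of i] i by (simp add: r_def)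
    have "?c = i - (if p ! 0 = 1 then 1 else 0)" if "i < d"
      using card_normal_pairs_one_False[OF R] card_False_before[of i w r] that lr pr w first by simp
    moreover have "?c = n - i - (if p ! (n - 1) = n then 1 else 0)" if "d < i"
      using card_normal_pairs_one_True[OF R] card_True_from[of w i r] that lr pr w last n i by simp
    ultimately show ?thesis unfolding d' absmu using i by auto
  qed
  have none: "(even n \<and> p ! 0 = 1 \<longrightarrow> mu p = - int ((n div 2) choose 2))
      \<and> (even n \<and> p ! 0 = 2 \<longrightarrow> mu p = - int ((n div 2 + 1) choose 2))
      \<and> (odd n \<longrightarrow> mu p = int (((n + 1) div 2) choose 2))"
    if "adjs p = {}"
  proof -
    have "reps None w = {}" using reps that by simp
    then have c: "?c = (if p ! 0 = 1 then ((n + 1) div 2) choose 2 else (n div 2 + 1) choose 2)"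
      using card_normal_pairs_alternating[of w] first n by simp
    \<comment> \<open>For odd \<open>n\<close> the two counts agree; for even \<open>n\<close>,
      \<open>(n + 1) div 2\<close> equals \<open>n div 2\<close>.\<close>
    show ?thesis unfolding mu c by (auto elim!: oddE)
  qed
  show ?thesis
    by (rule conjI[OF sign], rule conjI, rule impI, erule ends, rule conjI, rule impI, erule triple,
        rule conjI, rule impI, erule many, rule conjI, intro allI impI, elim conjE, erule (1) two,
        rule conjI, intro allI impI, elim conjE, erule (1) one, rule impI, erule none)
qed

end
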